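(* Let $\mathscr{H}$ be a complex Hilbert space and let $T\in\mathbb{B}(\mathscr{H})$. Then $$\frac{1}{4}\|T\|+\frac14 \left(\|Re(T)\|+\|Im(T)\| \right)+\frac12 \left|\|Re(T)\|-\|Im(T)\| \right| \leq w(T).$$
   Context: $\mathbb{B}(\mathscr{H})$ denotes the bounded linear operators on the complex Hilbert space $\mathscr{H}$, $\|\cdot\|$ the operator norm. $Re(T)=\frac12(T+T^* )$ and $Im(T)=\frac1{2i}(T-T^* )$. The numerical radius is $w(T)=\sup\{|\langle Tx,x\rangle| : x\in\mathscr{H},\ \|x\|=1\}$. *)

theory Defs
  imports "HOL-Analysis.Analysis"
begin

text \<open>
  Complex Hilbert spaces as type classes on top of the real normed spaces of \<open>HOL-Analysis\<close>.
  The inner product is linear in its first argument and conjugate-linear in the second.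
\<close>

class complex_vector = real_vector +
  fixes scaleC :: "complex \<Rightarrow> 'a \<Rightarrow> 'a"  (infixr "*\<^sub>C" 75)
  assumes scaleC_add_right: "a *\<^sub>C (x + y) = a *\<^sub>C x + a *\<^sub>C y"
    and scaleC_add_left: "(a + b) *\<^sub>C x = a *\<^sub>C x + b *\<^sub>C x"
    and scaleC_scaleC: "a *\<^sub>C b *\<^sub>C x = (a * b) *\<^sub>C x"
    and scaleR_scaleC: "r *\<^sub>R x = complex_of_real r *\<^sub>C x"

text \<open>
  The axiom \<open>cinner_self\<close> says both that the inner product is positive definite and that the norm
  of \<^class>\<open>real_normed_vector\<close> is the one it induces.
\<close>

class complex_inner = complex_vector + real_normed_vector +
  fixes cinner :: "'a \<Rightarrow> 'a \<Rightarrow> complex"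
  assumes cinner_add_left: "cinner (x + y) z = cinner x z + cinner y z"
    and cinner_scaleC_left: "cinner (a *\<^sub>C x) y = a * cinner x y"
    and cinner_commute: "cinner y x = cnj (cinner x y)"
    and cinner_self: "cinner x x = complex_of_real ((norm x)\<^sup>2)"

class complex_hilbert = complex_inner + complete_space

instantiation complex :: complex_hilbert
begin

definition scaleC_complex :: "complex \<Rightarrow> complex \<Rightarrow> complex"
  where "scaleC_complex a x = a * x"

definition cinner_complex :: "complex \<Rightarrow> complex \<Rightarrow> complex"
  where "cinner_complex x y = x * cnj y"

instance
  by standard
    (simp_all add: scaleC_complex_def cinner_complex_def algebra_simps scaleR_conv_of_real
      flip: complex_norm_square)

end

definition bounded_clinear :: "('a::complex_inner \<Rightarrow> 'b::complex_inner) \<Rightarrow> bool"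
  where "bounded_clinear T \<longleftrightarrow> bounded_linear T \<and> (\<forall>a x. T (a *\<^sub>C x) = a *\<^sub>C T x)"

text \<open>
  For bounded \<open>T\<close> on a Hilbert space there is exactly one such \<open>S\<close>, and it is again bounded and
  complex-linear (Riesz representation).
\<close>

definition cadjoint :: "('a::complex_hilbert \<Rightarrow> 'a) \<Rightarrow> 'a \<Rightarrow> 'a"
  where "cadjoint T = (THE S. \<forall>x y. cinner (T x) y = cinner x (S y))"

definition op_Re :: "('a::complex_hilbert \<Rightarrow> 'a) \<Rightarrow> 'a \<Rightarrow> 'a"
  where "op_Re T = (\<lambda>x. (1 / 2) *\<^sub>C (T x + cadjoint T x))"

definition op_Im :: "('a::complex_hilbert \<Rightarrow> 'a) \<Rightarrow> 'a \<Rightarrow> 'a"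
  where "op_Im T = (\<lambda>x. (1 / (2 * \<i>)) *\<^sub>C (T x - cadjoint T x))"

text \<open>
  All values are non-negative, so inserting \<open>0\<close> only matters on the zero space, which has no unit
  vectors: there the supremum is \<open>0\<close> by convention, while \<open>Sup {} :: real\<close> is unspecified.
\<close>

definition numerical_radius :: "('a::complex_hilbert \<Rightarrow> 'a) \<Rightarrow> real"
  where "numerical_radius T = Sup (insert 0 {cmod (cinner (T x) x) | x. norm x = 1})"

end

theory Submission
  imports Defs
begin

text \<open>
  Suppose \<open>\<parallel>Re T\<parallel> \<ge> \<parallel>Im T\<parallel>\<close>. Since \<open>\<parallel>T\<parallel> \<le> \<parallel>Re T\<parallel> + \<parallel>Im T\<parallel>\<close>, the left-hand side is at most
  \<open>(\<parallel>Re T\<parallel> + \<parallel>Im T\<parallel>) / 2 + (\<parallel>Re T\<parallel> - \<parallel>Im T\<parallel>) / 2 = \<parallel>Re T\<parallel>\<close>, and symmetrically in the other case.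
  The norm of a self-adjoint operator is bounded by its numerical radius, and the quadratic forms of
  \<open>Re T\<close> and \<open>Im T\<close> are the real and imaginary parts of that of \<open>T\<close>, so both norms are at most \<open>w(T)\<close>.
\<close>

section \<open>Algebra of the inner product and the Cauchy-Schwarz inequality\<close>

lemma cinner_scaleC_right: "cinner x (a *\<^sub>C y) = cnj a * cinner x y"
  by (metis cinner_commute cinner_scaleC_left complex_cnj_mult)

lemma cinner_add_right: "cinner x (y + z) = cinner x y + cinner x z"
  by (metis cinner_add_left cinner_commute complex_cnj_add)

lemma scaleC_minus_one: "(- 1) *\<^sub>C x = - (x :: 'a::complex_vector)"
  using scaleR_scaleC[of "-1" x] by simp

lemma cinner_minus_left: "cinner (- x) y = - cinner x y"
  by (metis cinner_scaleC_left mult_minus1 scaleC_minus_one)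

lemma cinner_minus_right: "cinner x (- y) = - cinner x y"
  by (metis cinner_commute cinner_minus_left complex_cnj_minus)

lemma cinner_diff_left: "cinner (x - y) z = cinner x z - cinner y z"
  using cinner_add_left[of x "- y" z] by (simp add: cinner_minus_left)

lemma cinner_diff_right: "cinner x (y - z) = cinner x y - cinner x z"
  using cinner_add_right[of x y "- z"] by (simp add: cinner_minus_right)

lemma cinner_scaleR_left: "cinner (r *\<^sub>R x) y = of_real r * cinner x y"
  by (simp add: cinner_scaleC_left scaleR_scaleC)

lemma cinner_scaleR_right: "cinner x (r *\<^sub>R y) = of_real r * cinner x y"
  by (simp add: cinner_scaleC_right scaleR_scaleC)

lemmas cinner_simps =
  cinner_add_left cinner_add_right cinner_diff_left cinner_diff_right
  cinner_scaleC_left cinner_scaleC_right cinner_scaleR_left cinner_scaleR_right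

lemma Re_cinner_commute: "Re (cinner x y) = Re (cinner y x)"
  by (subst cinner_commute) simp

lemma norm_sq_eq_Re_cinner: "(norm x)\<^sup>2 = Re (cinner x x)"
  by (simp add: cinner_self)

lemma norm_add_sq: "(norm (x + y))\<^sup>2 = (norm x)\<^sup>2 + 2 * Re (cinner x y) + (norm (y::'a::complex_inner))\<^sup>2"
  unfolding norm_sq_eq_Re_cinner using Re_cinner_commute[of x y] by (simp add: cinner_simps)

lemma norm_diff_sq: "(norm (x - y))\<^sup>2 = (norm x)\<^sup>2 - 2 * Re (cinner x y) + (norm (y::'a::complex_inner))\<^sup>2"
  unfolding norm_sq_eq_Re_cinner using Re_cinner_commute[of x y] by (simp add: cinner_simps)

text \<open>The normed-space axioms speak of real scalars only; for complex ones, homogeneity has to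
  come from \<open>cinner_self\<close>.\<close>

lemma norm_scaleC: "norm (a *\<^sub>C x) = cmod a * norm (x::'a::complex_inner)"
proof -
  have "complex_of_real ((norm (a *\<^sub>C x))\<^sup>2) = a * cnj a * complex_of_real ((norm x)\<^sup>2)"
    by (simp add: cinner_scaleC_left cinner_scaleC_right cinner_self[symmetric] del: of_real_power)
  also have "\<dots> = complex_of_real ((cmod a * norm x)\<^sup>2)"
    by (simp add: complex_norm_square[symmetric] power_mult_distrib)
  finally have "(norm (a *\<^sub>C x))\<^sup>2 = (cmod a * norm x)\<^sup>2"
    using of_real_eq_iff by blast
  then show ?thesis by simp
qed

text \<open>Squaring the triangle inequality, already an axiom of the norm, and expanding leaves
  exactly this bound on the cross term.\<close>

lemma Re_cinner_le: "Re (cinner x y) \<le> norm x * norm (y::'a::complex_inner)"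
proof -
  have "(norm (x + y))\<^sup>2 \<le> (norm x + norm y)\<^sup>2"
    by (intro power_mono norm_triangle_ineq) simp
  then show ?thesis
    by (simp add: norm_add_sq power2_sum)
qed

lemma cmod_cinner_le: "cmod (cinner x y) \<le> norm x * norm (y::'a::complex_inner)"
proof (cases "cinner x y = 0")
  case False
  \<comment> \<open>The unimodular factor \<open>a\<close> rotates \<open>x\<close> so that the
    inner product becomes its own modulus; the bound on real parts then applies.\<close>
  define a where "a = cnj (sgn (cinner x y))"
  have "cmod a = 1"
    using False by (simp add: a_def norm_sgn)
  have "cinner (a *\<^sub>C x) y = cnj (sgn (cinner x y)) * cinner x y"
    by (simp add: a_def cinner_scaleC_left)
  also have "\<dots> = cmod (cinner x y)"
    using False by (simp add: sgn_div_norm scaleR_conv_of_real field_simps flip: complex_norm_square power2_eq_square)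
  finally have "cmod (cinner x y) = Re (cinner (a *\<^sub>C x) y)"
    by simp
  also have "\<dots> \<le> norm x * norm y"
    using Re_cinner_le[of "a *\<^sub>C x" y] \<open>cmod a = 1\<close> by (simp add: norm_scaleC)
  finally show ?thesis .
qed simp

section \<open>Riesz representation and the adjoint\<close>

text \<open>The representing vector is the minimizer of \<open>\<lambda>x. \<parallel>x\<parallel>\<^sup>2 - 2 f x\<close>.\<close>

lemma riesz_representation_real:
  fixes f :: "'a::complex_hilbert \<Rightarrow> real"
  assumes "bounded_linear f"
  obtains u where "\<And>v. f v = Re (cinner v u)"
proof -
  interpret f: bounded_linear f by fact
  define J where "J x = (norm x)\<^sup>2 - 2 * f x" for x
  define m where "m = Inf (range J)"
  obtain K where K: "\<And>x. norm (f x) \<le> norm x * K"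
    using f.bounded by blast
  \<comment> \<open>Completing the square: \<open>J x\<close> is at least
    \<open>(norm x - K)\<^sup>2 - K\<^sup>2\<close>.\<close>
  have "- K\<^sup>2 \<le> J x" for x
    using K[of x] zero_le_power2[of "norm x - K"] by (simp add: J_def power2_diff)
  then have bdd: "bdd_below (range J)"
    by (auto intro!: bdd_belowI)
  have m_le: "m \<le> J x" for x
    unfolding m_def using bdd by (intro cInf_lower) auto
  have "\<exists>x. J x < m + inverse (real (Suc n))" for n
    using cInf_lessD[of "range J" "m + inverse (real (Suc n))"] by (auto simp: m_def)
  then obtain X where X: "\<And>n. J (X n) < m + inverse (real (Suc n))"
    by metis
  \<comment> \<open>Parallelogram law: the linear terms cancel against those at the midpoint of
    \<open>x\<close> and \<open>y\<close>, where \<open>J\<close> is still at least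
    \<open>m\<close>. Hence near-minimizers are close together.\<close>
  have dist_sq: "(norm (x - y))\<^sup>2 \<le> 2 * (J x - m) + 2 * (J y - m)" for x y
  proof -
    have "(norm (x - y))\<^sup>2 = 2 * J x + 2 * J y - 4 * J ((1 / 2) *\<^sub>R (x + y))"
      by (simp add: J_def norm_diff_sq norm_add_sq f.scaleR f.add power_divide
          cinner_scaleR_left cinner_scaleR_right field_simps)
    then show ?thesis using m_le[of "(1 / 2) *\<^sub>R (x + y)"] by simp
  qed
  have "Cauchy X"
  proof (rule CauchyI)
    fix e :: real assume "0 < e"
    \<comment> \<open>Two excesses below a quarter of \<open>e\<^sup>2\<close>, each doubled in
      \<open>dist_sq\<close>, add up to less than \<open>e\<^sup>2\<close>.\<close>
    then have "0 < e\<^sup>2 / 4" by simp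
    then obtain N where N: "inverse (real (Suc N)) < e\<^sup>2 / 4"
      using reals_Archimedean by blast
    have small: "J (X k) - m < e\<^sup>2 / 4" if "N \<le> k" for k
    proof -
      have "inverse (real (Suc k)) \<le> inverse (real (Suc N))"
        using that by (intro le_imp_inverse_le) auto
      then show ?thesis using X[of k] N by linarith
    qed
    have "norm (X i - X j) < e" if "N \<le> i" "N \<le> j" for i j
    proof (rule power2_less_imp_less)
      show "(norm (X i - X j))\<^sup>2 < e\<^sup>2"
        using dist_sq[of "X i" "X j"] small[OF that(1)] small[OF that(2)] by argo
    qed (use \<open>0 < e\<close> in simp)
    then show "\<exists>M. \<forall>i\<ge>M. \<forall>j\<ge>M. norm (X i - X j) < e" by blast
  qed
  then obtain u where u: "X \<longlonglongrightarrow> u"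
    using Cauchy_convergent convergent_def by blast
  have "(\<lambda>n. J (X n)) \<longlonglongrightarrow> J u"
    unfolding J_def by (intro tendsto_intros f.tendsto u)
  moreover have "(\<lambda>n. m + inverse (real (Suc n))) \<longlonglongrightarrow> m + 0"
    by (intro tendsto_intros LIMSEQ_inverse_real_of_nat)
  ultimately have "J u \<le> m + 0"
    by (rule LIMSEQ_le) (use X less_imp_le in blast)
  then have min: "J u \<le> J x" for x
    using m_le[of x] by simp
  have "f v = Re (cinner v u)" for v
  proof -
    define d where "d = Re (cinner v u) - f v"
    \<comment> \<open>Minimality is tested at \<open>u + t *\<^sub>R v\<close> with
      \<open>t = - d / c\<close>. The optimal \<open>t\<close> would have
      \<open>(norm v)\<^sup>2\<close> as denominator; the added 1 keeps it positive when
      \<open>v = 0\<close> and still forces \<open>d = 0\<close>.\<close>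
    define c where "c = (norm v)\<^sup>2 + 1"
    have "0 < c" and sq: "(norm v)\<^sup>2 = c - 1" by (simp_all add: c_def add_nonneg_pos)
    have expand: "J (u + t *\<^sub>R v) - J u = t\<^sup>2 * (norm v)\<^sup>2 + 2 * t * d" for t
      using Re_cinner_commute[of u v]
      by (simp add: J_def norm_add_sq f.add f.scaleR cinner_simps d_def power_mult_distrib algebra_simps)
    have "0 \<le> (- d / c)\<^sup>2 * (norm v)\<^sup>2 + 2 * (- d / c) * d"
      using min[of "u + (- d / c) *\<^sub>R v"] expand[of "- d / c"] by linarith
    then have "0 \<le> ((- d / c)\<^sup>2 * (norm v)\<^sup>2 + 2 * (- d / c) * d) * c\<^sup>2"
      by simp
    also have "\<dots> = - d\<^sup>2 * (c + 1)"
      unfolding sq using \<open>0 < c\<close> by (simp add: field_simps power2_eq_square)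
    finally have "d\<^sup>2 * (c + 1) \<le> 0" by simp
    then have "d = 0"
      using \<open>0 < c\<close> by (simp add: mult_le_0_iff)
    then show ?thesis by (simp add: d_def)
  qed
  then show thesis using that by blast
qed

lemma cinner_bounded_linear_left: "bounded_linear (\<lambda>x. cinner x (y::'a::complex_inner))"
  by (rule bounded_linear_intro[where K = "norm y"])
    (simp_all add: cinner_simps scaleR_conv_of_real cmod_cinner_le)

lemma cinner_right_ext:
  fixes u v :: "'a::complex_inner"
  assumes "\<And>x. cinner x u = cinner x v"
  shows "u = v"
proof -
  have "(norm (u - v))\<^sup>2 = 0"
    using assms[of "u - v"] by (simp add: norm_sq_eq_Re_cinner cinner_diff_right)
  then show ?thesis by simp
qed

text \<open>The definite description in \<open>cadjoint\<close> must be discharged: existence is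
  Riesz applied to \<open>Re (cinner (T x) y)\<close> for each \<open>y\<close>, uniqueness is
  \<open>cinner_right_ext\<close>.\<close>

lemma cadjoint_works:
  fixes T :: "'a::complex_hilbert \<Rightarrow> 'a"
  assumes "bounded_clinear T"
  shows "cinner (T x) y = cinner x (cadjoint T y)"
proof -
  have T: "bounded_linear T" and T_scaleC: "\<And>a x. T (a *\<^sub>C x) = a *\<^sub>C T x"
    using assms by (auto simp: bounded_clinear_def)
  have "\<exists>u. \<forall>x. cinner (T x) y = cinner x u" for y
  proof -
    have "bounded_linear (\<lambda>x. Re (cinner (T x) y))"
      by (intro bounded_linear_compose[OF bounded_linear_Re]
          bounded_linear_compose[OF cinner_bounded_linear_left T])
    then obtain u where u: "\<And>x. Re (cinner (T x) y) = Re (cinner x u)"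
      using riesz_representation_real by blast
    \<comment> \<open>Riesz matches real parts only; replacing \<open>x\<close> by
      \<open>\<i> *\<^sub>C x\<close> turns imaginary parts into real ones, by complex linearity of
      \<open>T\<close>.\<close>
    have "cinner (T x) y = cinner x u" for x
      using u[of x] u[of "\<i> *\<^sub>C x"] by (simp add: complex_eq_iff T_scaleC cinner_scaleC_left)
    then show ?thesis by blast
  qed
  then obtain S where S: "\<forall>x y. cinner (T x) y = cinner x (S y)"
    by metis
  have "\<forall>x y. cinner (T x) y = cinner x (cadjoint T y)"
    unfolding cadjoint_def
  proof (rule theI[of _ S])
    fix S' assume S': "\<forall>x y. cinner (T x) y = cinner x (S' y)"
    show "S' = S"
    proof (rule ext, rule cinner_right_ext)
      show "cinner x (S' y) = cinner x (S y)" for x y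
        using S S' by metis
    qed
  qed (fact S)
  then show ?thesis by blast
qed

lemma cinner_cadjoint_left:
  assumes "bounded_clinear T"
  shows "cinner (cadjoint T x) y = cinner x (T y)"
  by (metis assms cadjoint_works cinner_commute)

section \<open>Norm bounds from quadratic forms\<close>

text \<open>By symmetry, polarization writes \<open>4 * Re (cinner (A x) y)\<close> as the form at
  \<open>x + y\<close> minus the form at \<open>x - y\<close>; the parallelogram law bounds this,
  and \<open>y\<close> is then chosen along \<open>A x\<close>.\<close>

lemma norm_le_of_symmetric:
  fixes A :: "'a::complex_inner \<Rightarrow> 'a"
  assumes sym: "\<And>x y. Re (cinner (A x) y) = Re (cinner x (A y))"
    and form: "\<And>x. \<bar>Re (cinner (A x) x)\<bar> \<le> c * (norm x)\<^sup>2"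
    and add: "\<And>x y. A (x + y) = A x + A y"
  shows "norm (A x) \<le> c * norm x"
proof -
  have diff: "A (x - y) = A x - A y" for x y
    using add[of "x - y" y] by (simp add: algebra_simps)
  have polar: "4 * Re (cinner (A x) y) \<le> c * (2 * (norm x)\<^sup>2 + 2 * (norm y)\<^sup>2)" for x y
  proof -
    have "4 * Re (cinner (A x) y) = Re (cinner (A (x + y)) (x + y)) - Re (cinner (A (x - y)) (x - y))"
      using sym[of y x] Re_cinner_commute[of y "A x"] by (simp add: add diff cinner_simps)
    also have "\<dots> \<le> c * (norm (x + y))\<^sup>2 + c * (norm (x - y))\<^sup>2"
      using form[of "x + y"] form[of "x - y"] by linarith
    also have "\<dots> = c * (2 * (norm x)\<^sup>2 + 2 * (norm y)\<^sup>2)"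
      by (simp add: norm_add_sq norm_diff_sq algebra_simps)
    finally show ?thesis .
  qed
  show ?thesis
  proof (cases "A x = 0 \<or> x = 0")
    case True
    then show ?thesis
    proof
      assume "A x = 0"
      then show ?thesis
        \<comment> \<open>No sign of \<open>c\<close> is assumed; \<open>form\<close> at
          \<open>x\<close> itself yields \<open>0 \<le> c\<close> unless
          \<open>x = 0\<close>.\<close>
        using order_trans[OF abs_ge_zero form[of x]] by (auto simp: zero_le_mult_iff)
    qed (use add[of 0 0] in simp)
  next
    case False
    \<comment> \<open>Giving \<open>y\<close> the length of \<open>x\<close> makes the bound in
      \<open>polar\<close> equal to \<open>4 * c * (norm x)\<^sup>2\<close>.\<close>
    define y where "y = (norm x / norm (A x)) *\<^sub>R A x"
    have "norm y = norm x"
      using False by (simp add: y_def)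
    moreover have "Re (cinner (A x) y) = norm x * norm (A x)"
      using False by (simp add: y_def cinner_scaleR_right cinner_self power2_eq_square)
    ultimately have "norm x * norm (A x) \<le> norm x * (c * norm x)"
      using polar[of x y] by (simp add: power2_eq_square algebra_simps)
    then show ?thesis using False by simp
  qed
qed

section \<open>The numerical radius\<close>

text \<open>A real \<open>Sup\<close> is an upper bound only for sets bounded above; here
  Cauchy-Schwarz supplies the bound \<open>onorm T\<close>.\<close>

lemma numerical_radius_bdd_above:
  assumes "bounded_clinear T"
  shows "bdd_above (insert 0 {cmod (cinner (T x) x) | x. norm x = 1})"
proof -
  have "bounded_linear T"
    using assms by (simp add: bounded_clinear_def)
  then have "cmod (cinner (T x) x) \<le> onorm T" if "norm x = 1" for x
    using cmod_cinner_le[of "T x" x] onorm[of T x] that by simp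
  then have "bdd_above {cmod (cinner (T x) x) | x. norm x = 1}"
    by (auto intro!: bdd_aboveI)
  then show ?thesis by simp
qed

lemma numerical_radius_nonneg:
  assumes "bounded_clinear T"
  shows "0 \<le> numerical_radius T"
  unfolding numerical_radius_def
  by (rule cSup_upper[OF _ numerical_radius_bdd_above[OF assms]]) simp

text \<open>Rescaling to a unit vector extends the supremum bound to all \<open>x\<close>, the form
  that \<open>norm_le_of_symmetric\<close> asks for.\<close>

lemma cmod_cinner_le_numerical_radius:
  fixes T :: "'a::complex_hilbert \<Rightarrow> 'a"
  assumes "bounded_clinear T"
  shows "cmod (cinner (T x) x) \<le> numerical_radius T * (norm x)\<^sup>2"
proof (cases "x = 0")
  case True
  then show ?thesis using cmod_cinner_le[of "T x" x] by simp
next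
  case False
  interpret T: bounded_linear T
    using assms by (simp add: bounded_clinear_def)
  define y where "y = (1 / norm x) *\<^sub>R x"
  have "norm y = 1" using False by (simp add: y_def)
  then have "cmod (cinner (T y) y) \<le> numerical_radius T"
    unfolding numerical_radius_def
    by (intro cSup_upper numerical_radius_bdd_above[OF assms]) auto
  moreover have "cmod (cinner (T y) y) = cmod (cinner (T x) x) / (norm x)\<^sup>2"
    using False by (simp add: y_def T.scaleR cinner_simps norm_mult norm_divide power2_eq_square)
  ultimately show ?thesis
    using False by (simp add: field_simps)
qed

section \<open>Real and imaginary parts of an operator\<close>

lemma cadjoint_add:
  assumes "bounded_clinear T"
  shows "cadjoint T (x + y) = cadjoint T x + cadjoint T y"
  by (rule cinner_right_ext)
    (simp add: cinner_add_right flip: cadjoint_works[OF assms])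

lemma cadjoint_scaleR:
  assumes "bounded_clinear T"
  shows "cadjoint T (r *\<^sub>R x) = r *\<^sub>R cadjoint T x"
  by (rule cinner_right_ext)
    (simp add: cinner_scaleR_right flip: cadjoint_works[OF assms])

lemma scaleC_scaleR_commute: "a *\<^sub>C r *\<^sub>R x = r *\<^sub>R a *\<^sub>C (x::'a::complex_vector)"
  by (simp add: scaleR_scaleC scaleC_scaleC mult.commute)

text \<open>\<open>op_Re T\<close> is symmetric and its quadratic form is the real part of that of
  \<open>T\<close>, so \<open>norm_le_of_symmetric\<close> applies with the numerical radius as
  \<open>c\<close>.\<close>

lemma norm_op_Re_le:
  fixes T :: "'a::complex_hilbert \<Rightarrow> 'a"
  assumes "bounded_clinear T"
  shows "norm (op_Re T x) \<le> numerical_radius T * norm x"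
proof (rule norm_le_of_symmetric)
  interpret T: bounded_linear T
    using assms by (simp add: bounded_clinear_def)
  note adj = cadjoint_works[OF assms] cinner_cadjoint_left[OF assms]
  show "Re (cinner (op_Re T x) y) = Re (cinner x (op_Re T y))" for x y
    by (simp add: op_Re_def cinner_simps adj)
  show "\<bar>Re (cinner (op_Re T x) x)\<bar> \<le> numerical_radius T * (norm x)\<^sup>2" for x
  proof -
    have "Re (cinner (op_Re T x) x) = Re (cinner (T x) x)"
      using Re_cinner_commute[of x "T x"]
      by (simp add: op_Re_def cinner_simps cinner_cadjoint_left[OF assms])
    then show ?thesis
      using cmod_cinner_le_numerical_radius[OF assms, of x] abs_Re_le_cmod order_trans by metis
  qed
  show "op_Re T (x + y) = op_Re T x + op_Re T y" for x y
    by (simp add: op_Re_def T.add cadjoint_add[OF assms] add.commute add.left_commute flip: scaleC_add_right)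
qed

text \<open>Division by \<open>2 * \<i>\<close> makes the skew part symmetric, with the imaginary
  part of the form of \<open>T\<close> as its form.\<close>

lemma norm_op_Im_le:
  fixes T :: "'a::complex_hilbert \<Rightarrow> 'a"
  assumes "bounded_clinear T"
  shows "norm (op_Im T x) \<le> numerical_radius T * norm x"
proof (rule norm_le_of_symmetric)
  interpret T: bounded_linear T
    using assms by (simp add: bounded_clinear_def)
  note adj = cadjoint_works[OF assms] cinner_cadjoint_left[OF assms]
  show "Re (cinner (op_Im T x) y) = Re (cinner x (op_Im T y))" for x y
    by (simp add: op_Im_def cinner_simps adj) (simp add: field_simps)
  show "\<bar>Re (cinner (op_Im T x) x)\<bar> \<le> numerical_radius T * (norm x)\<^sup>2" for x
  proof -
    have "Im (cinner x (T x)) = - Im (cinner (T x) x)"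
      using arg_cong[OF cinner_commute[of x "T x"], of Im] by simp
    then have "Re (cinner (op_Im T x) x) = Im (cinner (T x) x)"
      by (simp add: op_Im_def cinner_simps cinner_cadjoint_left[OF assms])
    then show ?thesis
      using cmod_cinner_le_numerical_radius[OF assms, of x] abs_Im_le_cmod order_trans by metis
  qed
  show "op_Im T (x + y) = op_Im T x + op_Im T y" for x y
    by (simp add: op_Im_def T.add cadjoint_add[OF assms] add_diff_add flip: scaleC_add_right)
qed

text \<open>Boundedness is what lets \<open>onorm\<close> be used as a bound on the operator; the
  preceding estimate provides the constant.\<close>

lemma bounded_linear_op_Re:
  fixes T :: "'a::complex_hilbert \<Rightarrow> 'a"
  assumes "bounded_clinear T"
  shows "bounded_linear (op_Re T)"
proof (rule bounded_linear_intro[where K = "numerical_radius T"])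
  interpret T: bounded_linear T
    using assms by (simp add: bounded_clinear_def)
  show "op_Re T (x + y) = op_Re T x + op_Re T y" for x y
    by (simp add: op_Re_def T.add cadjoint_add[OF assms] add.commute add.left_commute flip: scaleC_add_right)
  show "op_Re T (r *\<^sub>R x) = r *\<^sub>R op_Re T x" for r x
    by (simp add: op_Re_def T.scaleR cadjoint_scaleR[OF assms] flip: scaleR_add_right scaleC_scaleR_commute)
qed (simp add: norm_op_Re_le[OF assms] mult.commute)

lemma bounded_linear_op_Im:
  fixes T :: "'a::complex_hilbert \<Rightarrow> 'a"
  assumes "bounded_clinear T"
  shows "bounded_linear (op_Im T)"
proof (rule bounded_linear_intro[where K = "numerical_radius T"])
  interpret T: bounded_linear T
    using assms by (simp add: bounded_clinear_def)
  show "op_Im T (x + y) = op_Im T x + op_Im T y" for x y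
    by (simp add: op_Im_def T.add cadjoint_add[OF assms] add_diff_add flip: scaleC_add_right)
  show "op_Im T (r *\<^sub>R x) = r *\<^sub>R op_Im T x" for r x
    by (simp add: op_Im_def T.scaleR cadjoint_scaleR[OF assms] flip: scaleR_diff_right scaleC_scaleR_commute)
qed (simp add: norm_op_Im_le[OF assms] mult.commute)

lemma cartesian_decomposition: "T x = op_Re T x + \<i> *\<^sub>C op_Im T x"
proof -
  have "op_Re T x + \<i> *\<^sub>C op_Im T x
      = (1 / 2) *\<^sub>C ((T x + cadjoint T x) + (T x - cadjoint T x))"
    by (simp only: op_Re_def op_Im_def scaleC_scaleC scaleC_add_right) simp
  also have "\<dots> = (1 / 2 :: real) *\<^sub>R (2 *\<^sub>R T x)"
    by (simp add: scaleR_scaleC[of "1/2"] scaleR_2)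
  finally show ?thesis by simp
qed

lemma onorm_le_onorm_op_Re_op_Im:
  fixes T :: "'a::complex_hilbert \<Rightarrow> 'a"
  assumes "bounded_clinear T"
  shows "onorm T \<le> onorm (op_Re T) + onorm (op_Im T)"
proof (rule onorm_bound)
  note bl = bounded_linear_op_Re[OF assms] bounded_linear_op_Im[OF assms]
  show "0 \<le> onorm (op_Re T) + onorm (op_Im T)"
    using bl by (simp add: onorm_pos_le)
  show "norm (T x) \<le> (onorm (op_Re T) + onorm (op_Im T)) * norm x" for x
  proof -
    have "norm (T x) \<le> norm (op_Re T x) + norm (op_Im T x)"
      using norm_triangle_ineq[of "op_Re T x" "\<i> *\<^sub>C op_Im T x"]
      by (simp add: norm_scaleC flip: cartesian_decomposition)
    also have "\<dots> \<le> onorm (op_Re T) * norm x + onorm (op_Im T) * norm x"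
      using bl by (intro add_mono onorm)
    finally show ?thesis by (simp add: distrib_right)
  qed
qed

theorem theorem2p15:
  fixes T :: "'a::complex_hilbert \<Rightarrow> 'a"
  assumes "bounded_clinear T"
  shows "1 / 4 * onorm T + 1 / 4 * (onorm (op_Re T) + onorm (op_Im T))
           + 1 / 2 * \<bar>onorm (op_Re T) - onorm (op_Im T)\<bar> \<le> numerical_radius T"
proof -
  have "onorm (op_Re T) \<le> numerical_radius T" "onorm (op_Im T) \<le> numerical_radius T"
    by (intro onorm_bound numerical_radius_nonneg norm_op_Re_le norm_op_Im_le assms)+
  then show ?thesis
    \<comment> \<open>With \<open>onorm T\<close> replaced by the sum of the two norms, the
      left-hand side becomes their maximum.\<close>
    using onorm_le_onorm_op_Re_op_Im[OF assms] by argo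
qed

end
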